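(* Let $p:\mathbb{C}\to[0,\infty[$ be a growth condition and let $g\in A_p$ be non-constant. (i) If the condition $M(g,r)=O(p(r))$ as $r\to\infty$ is not satisfied (which happens in particular when $p(r)=o(r)$ as $r\to\infty$), then $\sigma(V_g,A_p)=\mathbb{C}$. (ii) If $M(g,r)=O(p(r))$ as $r\to\infty$, then $\sigma(V_g,A_p)=\{0\}$. In this case $g$ is a polynomial and $r=O(p(r))$ as $r\to\infty$. Moreover, in both cases $\sigma(V_g,A_p)=\{0\}\cup\overline{\{\lambda\in\mathbb{C}\setminus\{0\} : e^{g/\lambda}\notin A_p\}}$.
   Context: $H(\mathbb{C})$ is the space of entire functions. A growth condition is a function $p:\mathbb{C}\to[0,\infty[$ that is continuous, subharmonic, radial, increases with $|z|$, and satisfies $\log(1+|z|^2)=o(p(|z|))$ as $|z|\to\infty$ and $p(2|z|)=O(p(|z|))$ as $|z|\to\infty$. The Hörmander algebra is $A_p=\{f\in H(\mathbb{C}) : \text{there is } A>0 \text{ with } \sup_{z\in\mathbb{C}}|f(z)|\exp(-Ap(z))<\infty\}$, endowed with its natural (locally convex) inductive limit topology, i.e. as the inductive limit over $A>0$ of the Banach spaces of entire functions $f$ with norm $\sup_{z}|f(z)|\exp(-Ap(z))<\infty$. For entire $g$, $M(g,r)=\max\{|g(z)| : |z|=r\}$. The Volterra operator with symbol $g$ is $V_g f(z)=\int_0^z f(\zeta)g'(\zeta)\,d\zeta$, $z\in\mathbb{C}$; for $g\in A_p$ it is a continuous operator from $A_p$ to itself. For a continuous operator $T:X\to X$ on a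 Hausdorff locally convex space $X$, the resolvent set $\rho(T,X)$ is the set of $\lambda\in\mathbb{C}$ such that $T-\lambda I:X\to X$ is bijective with continuous inverse, and the spectrum is $\sigma(T,X)=\mathbb{C}\setminus\rho(T,X)$. The bar denotes closure in $\mathbb{C}$. *)

theory Defs
  imports "HOL-Complex_Analysis.Complex_Analysis" "HOL-Library.Landau_Symbols"
begin

text \<open>
  Real-valued subharmonic functions on the plane: upper semicontinuity and the sub-mean value
  inequality on every circle.  A finite-valued subharmonic function is integrable over every
  circle; this is stated explicitly because \<^const>\<open>integral\<close> is \<open>0\<close> on non-integrable functions.
\<close>

definition subharmonic :: "(complex \<Rightarrow> real) \<Rightarrow> bool" where
  "subharmonic u \<longleftrightarrow>
     (\<forall>z c. u z < c \<longrightarrow> (\<forall>\<^sub>F w in nhds z. u w < c)) \<and>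
     (\<forall>z r. 0 < r \<longrightarrow>
        (\<lambda>t. u (z + complex_of_real r * cis t)) integrable_on {0..2 * pi} \<and>
        u z \<le> integral {0..2 * pi} (\<lambda>t. u (z + complex_of_real r * cis t)) / (2 * pi))"

text \<open>``Increases with \<open>|z|\<close>'' is read in the weak sense.\<close>

definition growth_condition :: "(complex \<Rightarrow> real) \<Rightarrow> bool" where
  "growth_condition p \<longleftrightarrow>
     (\<forall>z. 0 \<le> p z) \<and>
     continuous_on UNIV p \<and>
     subharmonic p \<and>
     (\<forall>z w. cmod z = cmod w \<longrightarrow> p z = p w) \<and>
     (\<forall>z w. cmod z \<le> cmod w \<longrightarrow> p z \<le> p w) \<and>
     (\<lambda>z. ln (1 + (cmod z)\<^sup>2)) \<in> o[at_infinity](\<lambda>z. p (complex_of_real (cmod z))) \<and>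
     (\<lambda>z. p (complex_of_real (2 * cmod z))) \<in> O[at_infinity](\<lambda>z. p (complex_of_real (cmod z)))"

text \<open>The Banach spaces (steps) whose inductive limit is the Hoermander algebra.\<close>

definition hormander_step :: "(complex \<Rightarrow> real) \<Rightarrow> real \<Rightarrow> (complex \<Rightarrow> complex) set" where
  "hormander_step p A =
     {f. f holomorphic_on UNIV \<and> bdd_above (range (\<lambda>z. cmod (f z) * exp (- A * p z)))}"

definition hormander_norm :: "(complex \<Rightarrow> real) \<Rightarrow> real \<Rightarrow> (complex \<Rightarrow> complex) \<Rightarrow> real" where
  "hormander_norm p A f = (SUP z. cmod (f z) * exp (- A * p z))"

definition hormander_algebra :: "(complex \<Rightarrow> real) \<Rightarrow> (complex \<Rightarrow> complex) set" where
  "hormander_algebra p = (\<Union>A\<in>{0<..}. hormander_step p A)"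

definition absolutely_convex :: "('a \<Rightarrow> complex) set \<Rightarrow> bool" where
  "absolutely_convex W \<longleftrightarrow>
     (\<forall>f\<in>W. \<forall>h\<in>W. \<forall>a b. cmod a + cmod b \<le> 1 \<longrightarrow> (\<lambda>z. a * f z + b * h z) \<in> W)"

text \<open>
  The locally convex inductive limit topology is the finest locally convex topology for which all
  inclusions of the steps are continuous.  A base of neighbourhoods of \<open>0\<close> is given by the
  absolutely convex sets that meet every step in a neighbourhood of \<open>0\<close> for the norm of that step.
\<close>

definition inductive_nhd0 :: "(complex \<Rightarrow> real) \<Rightarrow> (complex \<Rightarrow> complex) set \<Rightarrow> bool" where
  "inductive_nhd0 p W \<longleftrightarrow>
     W \<subseteq> hormander_algebra p \<and> absolutely_convex W \<and>
     (\<forall>A>0. \<exists>e>0. \<forall>f\<in>hormander_step p A. hormander_norm p A f < e \<longrightarrow> f \<in> W)"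

definition hormander_topology :: "(complex \<Rightarrow> real) \<Rightarrow> (complex \<Rightarrow> complex) topology" where
  "hormander_topology p = topology (\<lambda>U. U \<subseteq> hormander_algebra p \<and>
     (\<forall>f\<in>U. \<exists>W. inductive_nhd0 p W \<and> (\<forall>h\<in>W. (\<lambda>z. f z + h z) \<in> U)))"

lemma inductive_nhd0_Int:
  assumes V: "inductive_nhd0 p V" and W: "inductive_nhd0 p W"
  shows "inductive_nhd0 p (V \<inter> W)"
  unfolding inductive_nhd0_def
proof (intro conjI allI impI)
  show "V \<inter> W \<subseteq> hormander_algebra p"
    using V by (auto simp: inductive_nhd0_def)
  have "absolutely_convex V" "absolutely_convex W"
    using V W by (simp_all add: inductive_nhd0_def)
  then show "absolutely_convex (V \<inter> W)"
    by (simp add: absolutely_convex_def)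
  fix A :: real assume "A > 0"
  obtain d where d: "d > 0" "\<forall>f\<in>hormander_step p A. hormander_norm p A f < d \<longrightarrow> f \<in> V"
    using V \<open>A > 0\<close> by (auto simp: inductive_nhd0_def)
  obtain e where e: "e > 0" "\<forall>f\<in>hormander_step p A. hormander_norm p A f < e \<longrightarrow> f \<in> W"
    using W \<open>A > 0\<close> by (auto simp: inductive_nhd0_def)
  show "\<exists>e>0. \<forall>f\<in>hormander_step p A. hormander_norm p A f < e \<longrightarrow> f \<in> V \<inter> W"
    using d e by (intro exI[of _ "min d e"]) simp
qed

lemma openin_hormander_topology:
  "openin (hormander_topology p) U \<longleftrightarrow> U \<subseteq> hormander_algebra p \<and>
     (\<forall>f\<in>U. \<exists>W. inductive_nhd0 p W \<and> (\<forall>h\<in>W. (\<lambda>z. f z + h z) \<in> U))"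
proof -
  define L where "L = (\<lambda>U. U \<subseteq> hormander_algebra p \<and>
     (\<forall>f\<in>U. \<exists>W. inductive_nhd0 p W \<and> (\<forall>h\<in>W. (\<lambda>z. f z + h z) \<in> U)))"
  have "L (S \<inter> T)" if S: "L S" and T: "L T" for S T
    unfolding L_def
  proof (intro conjI ballI)
    show "S \<inter> T \<subseteq> hormander_algebra p" using S by (auto simp: L_def)
    fix f assume f: "f \<in> S \<inter> T"
    obtain V where V: "inductive_nhd0 p V" "\<forall>h\<in>V. (\<lambda>z. f z + h z) \<in> S"
      using S f unfolding L_def by auto
    obtain W where W: "inductive_nhd0 p W" "\<forall>h\<in>W. (\<lambda>z. f z + h z) \<in> T"
      using T f unfolding L_def by auto
    show "\<exists>W. inductive_nhd0 p W \<and> (\<forall>h\<in>W. (\<lambda>z. f z + h z) \<in> S \<inter> T)"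
      using V(2) W(2) inductive_nhd0_Int[OF V(1) W(1)] by (intro exI[of _ "V \<inter> W"]) simp
  qed
  moreover have "L (\<Union>K)" if K: "\<forall>S\<in>K. L S" for K
    unfolding L_def
  proof (intro conjI ballI)
    show "\<Union>K \<subseteq> hormander_algebra p" using K by (auto simp: L_def)
    fix f assume "f \<in> \<Union>K"
    then obtain S where S: "S \<in> K" "f \<in> S" by (rule UnionE)
    with K have "\<exists>W. inductive_nhd0 p W \<and> (\<forall>h\<in>W. (\<lambda>z. f z + h z) \<in> S)"
      unfolding L_def by simp
    then obtain W where W: "inductive_nhd0 p W" "\<forall>h\<in>W. (\<lambda>z. f z + h z) \<in> S"
      by (elim exE conjE)
    show "\<exists>W. inductive_nhd0 p W \<and> (\<forall>h\<in>W. (\<lambda>z. f z + h z) \<in> \<Union>K)"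
      using W S(1) by (intro exI[of _ W] conjI ballI UnionI[of S]) simp_all
  qed
  ultimately have "istopology L" unfolding istopology_def by simp
  then have "openin (topology L) = L" by (rule topology_inverse')
  then show ?thesis
    unfolding hormander_topology_def L_def by (rule fun_cong)
qed

lemma hormander_step_mono:
  assumes p: "\<And>z. 0 \<le> p z" and "A \<le> B"
  shows "hormander_step p A \<subseteq> hormander_step p B"
proof
  fix f assume f: "f \<in> hormander_step p A"
  then obtain C where C: "\<And>z. cmod (f z) * exp (- A * p z) \<le> C"
    unfolding hormander_step_def bdd_above_def by auto
  have C': "cmod (f z) * exp (- B * p z) \<le> C" for z
  proof -
    have "cmod (f z) * exp (- B * p z) \<le> cmod (f z) * exp (- A * p z)"
      using mult_right_mono[OF \<open>A \<le> B\<close> p[of z]] by (simp add: mult_left_mono)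
    then show ?thesis using C[of z] by linarith
  qed
  have "bdd_above (range (\<lambda>z. cmod (f z) * exp (- B * p z)))"
    by (rule bdd_aboveI2[of _ _ C]) (rule C')
  then show "f \<in> hormander_step p B"
    using f unfolding hormander_step_def by simp
qed

lemma hormander_step_lincomb:
  assumes "f \<in> hormander_step p A" "h \<in> hormander_step p A"
  shows "(\<lambda>z. a * f z + b * h z) \<in> hormander_step p A"
proof -
  obtain C D where C: "\<And>z. cmod (f z) * exp (- A * p z) \<le> C"
    and D: "\<And>z. cmod (h z) * exp (- A * p z) \<le> D"
    using assms unfolding hormander_step_def bdd_above_def by auto
  have bd: "cmod (a * f z + b * h z) * exp (- A * p z) \<le> cmod a * C + cmod b * D" for z
  proof -
    have "cmod (a * f z + b * h z) * exp (- A * p z)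
        \<le> (cmod a * cmod (f z) + cmod b * cmod (h z)) * exp (- A * p z)"
      using norm_triangle_ineq[of "a * f z" "b * h z"]
      by (intro mult_right_mono) (auto simp: norm_mult)
    also have "\<dots> = cmod a * (cmod (f z) * exp (- A * p z)) + cmod b * (cmod (h z) * exp (- A * p z))"
      by (simp add: algebra_simps)
    also have "\<dots> \<le> cmod a * C + cmod b * D"
      by (intro add_mono mult_left_mono C D) auto
    finally show ?thesis .
  qed
  have "bdd_above (range (\<lambda>z. cmod (a * f z + b * h z) * exp (- A * p z)))"
    by (rule bdd_aboveI2[of _ _ "cmod a * C + cmod b * D"]) (rule bd)
  moreover have "(\<lambda>z. a * f z + b * h z) holomorphic_on UNIV"
    using assms unfolding hormander_step_def by (intro holomorphic_intros) auto
  ultimately show ?thesis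
    unfolding hormander_step_def by simp
qed

lemma hormander_algebra_lincomb:
  assumes p: "\<And>z. 0 \<le> p z" and "f \<in> hormander_algebra p" "h \<in> hormander_algebra p"
  shows "(\<lambda>z. a * f z + b * h z) \<in> hormander_algebra p"
proof -
  obtain A B where A: "A > 0" "f \<in> hormander_step p A" and B: "B > 0" "h \<in> hormander_step p B"
    using assms(2,3) unfolding hormander_algebra_def by auto
  have "f \<in> hormander_step p (max A B)" "h \<in> hormander_step p (max A B)"
    using A(2) B(2) hormander_step_mono[of p A "max A B", OF p] hormander_step_mono[of p B "max A B", OF p]
    by auto
  from hormander_step_lincomb[OF this] show ?thesis
    using A(1) unfolding hormander_algebra_def by (intro UN_I[of "max A B"]) auto
qed

lemma topspace_hormander_topology:
  assumes p: "\<And>z. 0 \<le> p z"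
  shows "topspace (hormander_topology p) = hormander_algebra p"
proof
  show "topspace (hormander_topology p) \<subseteq> hormander_algebra p"
    using openin_topspace[of "hormander_topology p"] unfolding openin_hormander_topology
    by (rule conjunct1)
  have "absolutely_convex (hormander_algebra p)"
    unfolding absolutely_convex_def by (intro ballI allI impI hormander_algebra_lincomb[of p, OF p])
  then have "inductive_nhd0 p (hormander_algebra p)"
    unfolding inductive_nhd0_def
    by (intro conjI allI impI exI[of _ 1]) (auto simp: hormander_algebra_def)
  moreover have "(\<lambda>z. f z + h z) \<in> hormander_algebra p"
    if "f \<in> hormander_algebra p" "h \<in> hormander_algebra p" for f h
    using hormander_algebra_lincomb[of p, OF p that, of 1 1] by simp
  ultimately have "openin (hormander_topology p) (hormander_algebra p)"
    unfolding openin_hormander_topology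
    by (intro conjI ballI exI[of _ "hormander_algebra p"]) auto
  then show "hormander_algebra p \<subseteq> topspace (hormander_topology p)"
    by (rule openin_subset)
qed

definition volterra :: "(complex \<Rightarrow> complex) \<Rightarrow> (complex \<Rightarrow> complex) \<Rightarrow> complex \<Rightarrow> complex" where
  "volterra g f z = contour_integral (linepath 0 z) (\<lambda>\<zeta>. f \<zeta> * deriv g \<zeta>)"

text \<open>
  Resolvent set and spectrum of an operator on a space of complex functions, with pointwise
  operations, whose carrier and topology are those of \<open>X\<close>.
\<close>

definition resolvent_set ::
  "('a \<Rightarrow> complex) topology \<Rightarrow> (('a \<Rightarrow> complex) \<Rightarrow> 'a \<Rightarrow> complex) \<Rightarrow> complex set" where
  "resolvent_set X T = {\<mu>. let S = (\<lambda>f z. T f z - \<mu> * f z) in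
     bij_betw S (topspace X) (topspace X) \<and> continuous_map X X (inv_into (topspace X) S)}"

definition spectrum ::
  "('a \<Rightarrow> complex) topology \<Rightarrow> (('a \<Rightarrow> complex) \<Rightarrow> 'a \<Rightarrow> complex) \<Rightarrow> complex set" where
  "spectrum X T = - resolvent_set X T"

text \<open>The supremum is a maximum for continuous \<open>g\<close> and \<open>r \<ge> 0\<close>, by compactness of the circle.\<close>

definition max_modulus :: "(complex \<Rightarrow> complex) \<Rightarrow> real \<Rightarrow> real" where
  "max_modulus g r = (SUP z\<in>sphere 0 r. cmod (g z))"

end

theory Submission
  imports Defs "HOL-Computational_Algebra.Fundamental_Theorem_Algebra"
begin

text \<open>
  The whole proof rests on a dichotomy between the symbols with \<open>cmod (g z) \<le> C * p z + D\<close> and the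
  others. If \<open>g\<close> satisfies such a bound, then \<open>exp (c * g)\<close> lies in the algebra for every \<open>c\<close>.
  Conversely, if \<open>exp (g / \<mu>)\<close> lies in the algebra for a single \<open>\<mu> \<noteq> 0\<close>, then \<open>Re (g / \<mu>)\<close> is
  dominated by \<open>p\<close>, and the Borel--Caratheodory inequality together with the doubling property of
  \<open>p\<close> gives the bound for \<open>cmod (g z)\<close> (\<open>exp_in_algebra_imp_growth\<close>). So the set of \<open>\<mu> \<noteq> 0\<close> with
  \<open>exp (g / \<mu>)\<close> outside the algebra is either empty or everything but \<open>0\<close>.

  The spectrum follows the same dichotomy. The point \<open>0\<close> always belongs to it, since \<open>V f\<close> vanishes
  at \<open>0\<close>. For \<open>\<mu> \<noteq> 0\<close>, the equation \<open>V f - \<mu> * f = 1\<close> forces \<open>f\<close> to be a nonzero multiple of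
  \<open>exp (g / \<mu>)\<close> (\<open>volterra_resolvent_const\<close>), so \<open>\<mu>\<close> is spectral whenever this exponential is
  outside the algebra. In the other case both \<open>exp (g / \<mu>)\<close> and \<open>exp (- g / \<mu>)\<close> are available as
  multipliers, and variation of constants gives the inverse explicitly
  (\<open>volterra_resolvent_eq\<close>); it maps each step of the inductive limit boundedly into another step,
  which yields continuity (\<open>step_bounded_continuous_map\<close>).

  Finally, iterating the doubling property shows that \<open>p\<close> grows at most like a power of \<open>cmod z\<close>.
  Hence a dominated symbol is a polynomial by Liouville's theorem, and being non-constant it grows
  at least linearly, which forces \<open>p\<close> to do so too.
\<close>

section \<open>Growth conditions\<close>

lemma growth_condition_nonneg: "growth_condition p \<Longrightarrow> 0 \<le> p z"
  unfolding growth_condition_def by blast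

lemma growth_condition_mono: "growth_condition p \<Longrightarrow> cmod z \<le> cmod w \<Longrightarrow> p z \<le> p w"
  unfolding growth_condition_def by blast

lemma growth_condition_norm: "growth_condition p \<Longrightarrow> p (complex_of_real (cmod z)) = p z"
  by (intro antisym growth_condition_mono[of p]) simp_all

lemma growth_condition_log:
  assumes p: "growth_condition p"
  obtains R where "\<And>z. R \<le> cmod z \<Longrightarrow> ln (1 + (cmod z)\<^sup>2) \<le> p z"
proof -
  have "(\<lambda>z. ln (1 + (cmod z)\<^sup>2)) \<in> o[at_infinity](\<lambda>z. p (complex_of_real (cmod z)))"
    using p unfolding growth_condition_def by blast
  from landau_o.smallD[OF this, of 1]
  have "\<forall>\<^sub>F z in at_infinity. ln (1 + (cmod z)\<^sup>2) \<le> p z"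
    by (simp add: growth_condition_norm[OF p] abs_of_nonneg growth_condition_nonneg[OF p])
  then show ?thesis
    using that by (auto simp: eventually_at_infinity)
qed

lemma growth_condition_exp_ge:
  assumes p: "growth_condition p"
  obtains K where "\<And>z. cmod z \<le> K * exp (p z)"
proof -
  obtain R where R: "\<And>z. R \<le> cmod z \<Longrightarrow> ln (1 + (cmod z)\<^sup>2) \<le> p z"
    using growth_condition_log[OF p] by blast
  have "cmod z \<le> max 1 R * exp (p z)" for z
  proof (cases "R \<le> cmod z")
    case True
    have "0 < 1 + (cmod z)\<^sup>2" by (simp add: add_pos_nonneg)
    then have "1 + (cmod z)\<^sup>2 \<le> exp (p z)"
      using iffD2[OF exp_le_cancel_iff R[OF True]] by simp
    moreover have "cmod z \<le> 1 + (cmod z)\<^sup>2"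
      using sum_squares_bound[of 1 "cmod z"] norm_ge_zero[of z] by (simp only: power_one)
    moreover have "1 * exp (p z) \<le> max 1 R * exp (p z)"
      by (intro mult_right_mono) auto
    ultimately show ?thesis by linarith
  next
    case False
    have "max 1 R * 1 \<le> max 1 R * exp (p z)"
      using growth_condition_nonneg[OF p] by (intro mult_left_mono) auto
    with False show ?thesis by linarith
  qed
  then show ?thesis by (rule that)
qed

lemma growth_condition_eventually_ge_1:
  assumes p: "growth_condition p"
  shows "\<forall>\<^sub>F r in at_top. 1 \<le> p (complex_of_real r)"
proof -
  obtain R where R: "\<And>z. R \<le> cmod z \<Longrightarrow> ln (1 + (cmod z)\<^sup>2) \<le> p z"
    using growth_condition_log[OF p] by blast
  have "\<forall>\<^sub>F r in at_top. max R (exp 1) \<le> (r::real)" by (rule eventually_ge_at_top)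
  then show ?thesis
  proof eventually_elim
    case (elim r)
    then have r: "exp 1 \<le> r" "R \<le> r" by auto
    have "1 \<le> r" using r(1) exp_ge_add_one_self[of 1] by linarith
    then have "r * 1 \<le> r * r" by (intro mult_left_mono) auto
    then have "exp 1 \<le> 1 + r\<^sup>2" using r(1) by (simp add: power2_eq_square)
    then have "1 \<le> ln (1 + r\<^sup>2)"
      by (subst ln_ge_iff) (auto intro: add_pos_nonneg)
    also have "\<dots> \<le> p (complex_of_real r)"
      using R[of "complex_of_real r"] r \<open>1 \<le> r\<close> by simp
    finally show ?case .
  qed
qed

lemma growth_condition_doubling:
  assumes p: "growth_condition p"
  obtains K D where "K \<ge> 0" "\<And>z. p (2 * z) \<le> K * p z + D"
proof -
  have "(\<lambda>z. p (complex_of_real (2 * cmod z))) \<in> O[at_infinity](\<lambda>z. p (complex_of_real (cmod z)))"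
    using p unfolding growth_condition_def by blast
  then obtain K where K: "K > 0" and "\<forall>\<^sub>F z in at_infinity.
      norm (p (complex_of_real (2 * cmod z))) \<le> K * norm (p (complex_of_real (cmod z)))"
    by (rule landau_o.bigE)
  moreover have "p (complex_of_real (2 * cmod z)) = p (2 * z)" for z
    using growth_condition_norm[OF p, of "2 * z"] by (simp add: norm_mult)
  ultimately have "\<forall>\<^sub>F z in at_infinity. p (2 * z) \<le> K * p z"
    by (simp add: growth_condition_norm[OF p] abs_of_nonneg growth_condition_nonneg[OF p])
  then obtain R where R: "\<And>z. R \<le> cmod z \<Longrightarrow> p (2 * z) \<le> K * p z"
    by (auto simp: eventually_at_infinity)
  have "p (2 * z) \<le> K * p z + p (2 * complex_of_real R)" for z
  proof (cases "R \<le> cmod z")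
    case True
    then show ?thesis using R[OF True] growth_condition_nonneg[OF p, of "2 * complex_of_real R"]
      by linarith
  next
    case False
    then have "p (2 * z) \<le> p (2 * complex_of_real R)"
      by (intro growth_condition_mono[OF p]) (simp add: norm_mult)
    moreover have "0 \<le> K * p z" using K growth_condition_nonneg[OF p, of z] by simp
    ultimately show ?thesis by linarith
  qed
  with K show ?thesis by (intro that[of K]) auto
qed

text \<open>
  Doubling the argument multiplies a majorant that is at least \<open>1\<close> by at most \<open>K + \<bar>D\<bar> \<le> 2 ^ n\<close>;
  iterating over the radii \<open>2 ^ m\<close> gives \<open>(2 ^ n) ^ m = (2 ^ m) ^ n\<close>, which is the \<open>n\<close>-th power of
  the radius.
\<close>

lemma growth_condition_polynomial:
  assumes p: "growth_condition p"
  obtains C n where "\<And>z. 1 \<le> cmod z \<Longrightarrow> p z \<le> C * cmod z ^ n"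
proof -
  obtain K D where K: "K \<ge> 0" and D: "\<And>z. p (2 * z) \<le> K * p z + D"
    using growth_condition_doubling[OF p] by blast
  obtain n where n: "K + \<bar>D\<bar> < 2 ^ n"
    using real_arch_pow[of 2 "K + \<bar>D\<bar>"] by auto
  have dyadic: "p z \<le> (p 2 + 1) * (2 ^ n) ^ m" if "cmod z \<le> 2 ^ Suc m" for m z
    using that
  proof (induction m arbitrary: z)
    case 0
    then show ?case using growth_condition_mono[OF p, of z 2] by simp
  next
    case (Suc m)
    let ?B = "(p 2 + 1) * (2 ^ n) ^ m"
    have "1 * 1 \<le> ?B"
      using growth_condition_nonneg[OF p, of 2] by (intro mult_mono) auto
    have "p z = p (2 * (z / 2))" by simp
    also have "\<dots> \<le> K * p (z / 2) + D" by (rule D)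
    also have "\<dots> \<le> K * ?B + \<bar>D\<bar> * ?B"
    proof (rule add_mono)
      show "K * p (z / 2) \<le> K * ?B"
        using Suc.prems K by (intro mult_left_mono Suc.IH) (simp_all add: norm_divide)
      show "D \<le> \<bar>D\<bar> * ?B"
        using mult_left_mono[of 1 ?B "\<bar>D\<bar>"] \<open>1 * 1 \<le> ?B\<close> by simp
    qed
    also have "\<dots> = (K + \<bar>D\<bar>) * ?B" by (simp add: algebra_simps)
    also have "\<dots> \<le> 2 ^ n * ?B"
      using n \<open>1 * 1 \<le> ?B\<close> by (intro mult_right_mono) auto
    finally show ?case by (simp add: mult_ac)
  qed
  have "p z \<le> (p 2 + 1) * cmod z ^ n" if z: "1 \<le> cmod z" for z
  proof -
    define m where "m = nat \<lfloor>log 2 (cmod z)\<rfloor>"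
    have log: "0 \<le> log 2 (cmod z)"
      using z by (intro zero_le_log_cancel_iff[THEN iffD2]) linarith+
    have m: "real m \<le> log 2 (cmod z)" "log 2 (cmod z) \<le> real (Suc m)"
      using log unfolding m_def by linarith+
    have "0 < cmod z" using z by linarith
    then have "2 ^ m \<le> cmod z"
      using m(1) by (simp add: le_log_iff powr_realpow)
    moreover have "cmod z \<le> 2 ^ Suc m"
      using m(2) \<open>0 < cmod z\<close> powr_realpow[of 2 "Suc m"] by (subst (asm) log_le_iff) auto
    ultimately have "p z \<le> (p 2 + 1) * (2 ^ m) ^ n" "(2 ^ m) ^ n \<le> cmod z ^ n"
      using dyadic[of z m] power_mono[of "2 ^ m" "cmod z" n] by (simp_all add: mult.commute flip: power_mult)
    moreover have "(p 2 + 1) * (2 ^ m) ^ n \<le> (p 2 + 1) * cmod z ^ n"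
      using calculation(2) growth_condition_nonneg[OF p, of 2] by (intro mult_left_mono) auto
    ultimately show ?thesis by linarith
  qed
  then show ?thesis by (rule that)
qed

text \<open>
  Since \<open>p\<close> tends to infinity, an additive constant is absorbed by \<open>p\<close> in an asymptotic bound.
\<close>

lemma bigo_growth_conditionI:
  assumes p: "growth_condition p"
    and m: "\<And>r. 0 \<le> r \<Longrightarrow> 0 \<le> m r" "\<And>r. 0 \<le> r \<Longrightarrow> m r \<le> C * p (complex_of_real r) + D"
  shows "m \<in> O[at_top](\<lambda>r. p (complex_of_real r))"
proof (rule landau_o.bigI[of "\<bar>C\<bar> + \<bar>D\<bar> + 1"])
  show "\<forall>\<^sub>F r in at_top. norm (m r) \<le> (\<bar>C\<bar> + \<bar>D\<bar> + 1) * norm (p (complex_of_real r))"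
    using growth_condition_eventually_ge_1[OF p] eventually_ge_at_top[of 0]
  proof eventually_elim
    case (elim r)
    let ?p = "p (complex_of_real r)"
    have "C * ?p \<le> \<bar>C\<bar> * ?p" "\<bar>D\<bar> * 1 \<le> \<bar>D\<bar> * ?p"
      using elim by (intro mult_right_mono mult_left_mono; simp)+
    then have "m r \<le> (\<bar>C\<bar> + \<bar>D\<bar> + 1) * ?p"
      using m(2)[OF elim(2)] elim(1) unfolding distrib_right by linarith
    then show ?case using m(1)[OF elim(2)] elim(1) by simp
  qed
qed simp

lemma bounded_image_cball_entire:
  fixes g :: "complex \<Rightarrow> complex"
  assumes "g holomorphic_on UNIV"
  obtains B where "\<And>z. cmod z \<le> r \<Longrightarrow> cmod (g z) \<le> B"
proof -
  have "continuous_on (cball 0 r) g"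
    using assms holomorphic_on_imp_continuous_on continuous_on_subset by blast
  then have "bounded (g ` cball 0 r)"
    by (intro compact_imp_bounded compact_continuous_image compact_cball)
  then obtain B where "\<forall>z\<in>cball 0 r. cmod (g z) \<le> B"
    unfolding bounded_iff by auto
  then show ?thesis by (intro that[of B]) simp
qed

lemma max_modulus_bigo_iff:
  assumes p: "growth_condition p" and g: "g holomorphic_on UNIV"
  shows "max_modulus g \<in> O[at_top](\<lambda>r. p (complex_of_real r)) \<longleftrightarrow>
    (\<exists>C D. \<forall>z. cmod (g z) \<le> C * p z + D)"
proof
  have upper: "cmod (g z) \<le> max_modulus g (cmod z)" for z
    unfolding max_modulus_def
  proof (rule cSUP_upper)
    obtain B where "\<And>w. cmod w \<le> cmod z \<Longrightarrow> cmod (g w) \<le> B"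
      using bounded_image_cball_entire[OF g] by blast
    then show "bdd_above ((\<lambda>z. cmod (g z)) ` sphere 0 (cmod z))"
      by (intro bdd_aboveI2[of _ _ B]) auto
  qed simp
  {
    assume "max_modulus g \<in> O[at_top](\<lambda>r. p (complex_of_real r))"
    then obtain C where C: "C > 0" "\<forall>\<^sub>F r in at_top.
        norm (max_modulus g r) \<le> C * norm (p (complex_of_real r))"
      by (rule landau_o.bigE)
    then obtain R where R: "\<And>r. R \<le> r \<Longrightarrow> \<bar>max_modulus g r\<bar> \<le> C * p (complex_of_real r)"
      by (auto simp: eventually_at_top_linorder abs_of_nonneg growth_condition_nonneg[OF p])
    obtain B where B: "\<And>z. cmod z \<le> R \<Longrightarrow> cmod (g z) \<le> B"
      using bounded_image_cball_entire[OF g] by blast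
    have "cmod (g z) \<le> C * p z + \<bar>B\<bar>" for z
    proof (cases "cmod z \<le> R")
      case True
      have "0 \<le> C * p z" using C(1) growth_condition_nonneg[OF p, of z] by simp
      then show ?thesis using B[OF True] by linarith
    next
      case False
      then show ?thesis
        using R[of "cmod z"] upper[of z] by (simp add: growth_condition_norm[OF p])
    qed
    then show "\<exists>C D. \<forall>z. cmod (g z) \<le> C * p z + D" by blast
  }
  assume "\<exists>C D. \<forall>z. cmod (g z) \<le> C * p z + D"
  then obtain C D where CD: "\<And>z. cmod (g z) \<le> C * p z + D" by blast
  show "max_modulus g \<in> O[at_top](\<lambda>r. p (complex_of_real r))"
  proof (rule bigo_growth_conditionI[OF p])
    fix r :: real assume r: "0 \<le> r"
    show "0 \<le> max_modulus g r"
      using order_trans[OF norm_ge_zero upper[of "complex_of_real r"]] r by simp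
    show "max_modulus g r \<le> C * p (complex_of_real r) + D"
      unfolding max_modulus_def
    proof (rule cSUP_least)
      show "sphere 0 r \<noteq> ({} :: complex set)" using r by simp
      fix z :: complex assume "z \<in> sphere 0 r"
      then show "cmod (g z) \<le> C * p (complex_of_real r) + D"
        using CD[of z] growth_condition_norm[OF p, of z] by simp
    qed
  qed
qed

section \<open>The algebra\<close>

lemma hormander_step_iff:
  "f \<in> hormander_step p A \<longleftrightarrow>
    f holomorphic_on UNIV \<and> (\<exists>C. \<forall>z. cmod (f z) \<le> C * exp (A * p z))"
  by (simp add: hormander_step_def bdd_above_def exp_minus field_simps)

lemma hormander_algebra_iff:
  "f \<in> hormander_algebra p \<longleftrightarrow>
    f holomorphic_on UNIV \<and> (\<exists>A>0. \<exists>C. \<forall>z. cmod (f z) \<le> C * exp (A * p z))"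
  by (auto simp: hormander_algebra_def hormander_step_iff)

lemma hormander_algebra_mult:
  assumes "f \<in> hormander_algebra p" "h \<in> hormander_algebra p"
  shows "(\<lambda>z. f z * h z) \<in> hormander_algebra p"
proof -
  obtain A C where A: "A > 0" "f holomorphic_on UNIV" "\<And>z. cmod (f z) \<le> C * exp (A * p z)"
    using assms(1) unfolding hormander_algebra_iff by blast
  obtain B D where B: "B > 0" "h holomorphic_on UNIV" "\<And>z. cmod (h z) \<le> D * exp (B * p z)"
    using assms(2) unfolding hormander_algebra_iff by blast
  have "cmod (f z * h z) \<le> C * D * exp ((A + B) * p z)" for z
  proof -
    have "cmod (f z) * cmod (h z) \<le> (C * exp (A * p z)) * (D * exp (B * p z))"
      using order_trans[OF norm_ge_zero A(3)] by (intro mult_mono A(3) B(3)) auto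
    then show ?thesis by (simp add: norm_mult exp_add algebra_simps)
  qed
  moreover have "(\<lambda>z. f z * h z) holomorphic_on UNIV"
    using A(2) B(2) by (intro holomorphic_intros)
  ultimately show ?thesis
    unfolding hormander_algebra_iff using add_pos_pos[OF A(1) B(1)] by blast
qed

lemma growth_condition_algebra_lincomb:
  assumes p: "growth_condition p" and "f \<in> hormander_algebra p" "h \<in> hormander_algebra p"
  shows "(\<lambda>z. a * f z + b * h z) \<in> hormander_algebra p"
  by (rule hormander_algebra_lincomb[of p, OF _ assms(2,3)]) (rule growth_condition_nonneg[OF p])

lemma hormander_algebra_const:
  assumes p: "growth_condition p"
  shows "(\<lambda>z. c) \<in> hormander_algebra p"
proof -
  have "cmod c \<le> cmod c * exp (1 * p z)" for z
    using growth_condition_nonneg[OF p, of z] mult_left_mono[of 1 "exp (p z)" "cmod c"] by simp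
  then show ?thesis
    unfolding hormander_algebra_iff using zero_less_one holomorphic_on_const by blast
qed

lemma hormander_algebra_poly:
  assumes p: "growth_condition p"
  shows "poly q \<in> hormander_algebra p"
proof (induction q)
  case 0
  have "poly 0 = (\<lambda>z :: complex. 0)" by auto
  then show ?case using hormander_algebra_const[OF p] by simp
next
  case (pCons a q)
  obtain K where "\<And>z. cmod z \<le> K * exp (p z)"
    using growth_condition_exp_ge[OF p] by blast
  then have "cmod z \<le> K * exp (1 * p z)" for z by simp
  then have "(\<lambda>z. z) \<in> hormander_algebra p"
    unfolding hormander_algebra_iff using zero_less_one holomorphic_on_ident by blast
  then have "(\<lambda>z. 1 * a + 1 * (z * poly q z)) \<in> hormander_algebra p"
    using p pCons.IH
    by (intro growth_condition_algebra_lincomb hormander_algebra_const hormander_algebra_mult)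
  moreover have "poly (pCons a q) = (\<lambda>z. 1 * a + 1 * (z * poly q z))" by auto
  ultimately show ?case by simp
qed

section \<open>Exponentials in the algebra\<close>

text \<open>
  The map \<open>w \<mapsto> w / (2 * A - w)\<close> takes the half-plane \<open>Re w < A\<close> into the unit disc and fixes \<open>0\<close>,
  so the Schwarz lemma applies to \<open>z \<mapsto> f (R * z) / (2 * A - f (R * z))\<close>.
\<close>

lemma Borel_Caratheodory_0:
  assumes f: "f holomorphic_on ball 0 R" and "f 0 = 0"
    and Re: "\<And>w. cmod w < R \<Longrightarrow> Re (f w) < A" and z: "cmod z < R"
  shows "(R - cmod z) * cmod (f z) \<le> 2 * A * cmod z"
proof -
  have R: "R > 0" using z norm_ge_zero[of z] by linarith
  have A: "A > 0" using Re[of 0] \<open>f 0 = 0\<close> R by simp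
  define h where "h w = f (of_real R * w)" for w
  define F where "F w = h w / (2 * of_real A - h w)" for w
  have inside: "cmod (of_real R * w) < R" if "cmod w < 1" for w
    using that R by (simp add: norm_mult)
  have Reh: "Re (h w) < A" if "cmod w < 1" for w
    unfolding h_def using Re inside[OF that] by blast
  have nz: "2 * of_real A - h w \<noteq> 0" if "cmod w < 1" for w
  proof
    assume "2 * of_real A - h w = 0"
    then have "Re (2 * of_real A - h w) = 0" by simp
    then show False using Reh[OF that] A by simp
  qed
  have "(f \<circ> (\<lambda>w. of_real R * w)) holomorphic_on ball 0 1"
    using inside by (intro holomorphic_on_compose_gen[OF _ f] holomorphic_intros) auto
  then have "h holomorphic_on ball 0 1" by (simp add: h_def[abs_def] o_def)
  then have "F holomorphic_on ball 0 1"
    unfolding F_def[abs_def] using nz by (intro holomorphic_intros) auto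
  moreover have "F 0 = 0" by (simp add: F_def h_def \<open>f 0 = 0\<close>)
  moreover have "cmod (F w) < 1" if w: "cmod w < 1" for w
  proof -
    have "(cmod (h w))\<^sup>2 < (cmod (2 * of_real A - h w))\<^sup>2"
      using mult_strict_left_mono[OF Reh[OF w] A]
      unfolding cmod_power2 by (simp add: power2_eq_square algebra_simps)
    then have "cmod (h w) < cmod (2 * of_real A - h w)"
      by (rule power2_less_imp_less) simp
    then show ?thesis using nz[OF w] by (simp add: F_def norm_divide)
  qed
  moreover have zR: "cmod (z / of_real R) < 1" using z R by (simp add: norm_divide)
  ultimately have "cmod (F (z / of_real R)) \<le> cmod (z / of_real R)"
    by (rule Schwarz_Lemma(1))
  moreover have "h (z / of_real R) = f z" using R by (simp add: h_def)
  ultimately have "cmod (f z) / cmod (2 * of_real A - f z) \<le> cmod z / R"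
    using R by (simp add: F_def norm_divide)
  moreover have "0 < cmod (2 * of_real A - f z)"
    using nz[OF zR] \<open>h (z / of_real R) = f z\<close> by simp
  ultimately have "R * cmod (f z) \<le> cmod z * cmod (2 * of_real A - f z)"
    using R by (simp add: field_simps)
  also have "\<dots> \<le> cmod z * (2 * A + cmod (f z))"
    using norm_triangle_ineq4[of "2 * of_real A" "f z"] A
    by (intro mult_left_mono) (auto simp: norm_mult)
  finally show ?thesis by (simp add: algebra_simps)
qed

text \<open>
  Membership of \<open>exp (g / \<mu>)\<close> bounds only the real part of \<open>g / \<mu>\<close> by a multiple of \<open>p\<close>. By
  Borel--Caratheodory a bound on the real part over the disc of radius \<open>2 * cmod z\<close> controls the
  modulus at \<open>z\<close>, and the doubling property of \<open>p\<close> absorbs the passage to the larger disc. This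
  is why membership for a single \<open>\<mu>\<close> has the same strength as membership for all \<open>\<mu>\<close>.
\<close>

lemma exp_in_algebra_imp_growth:
  assumes p: "growth_condition p" and g: "g holomorphic_on UNIV" and "\<mu> \<noteq> 0"
    and e: "(\<lambda>z. exp (g z / \<mu>)) \<in> hormander_algebra p"
  shows "\<exists>C D. \<forall>z. cmod (g z) \<le> C * p z + D"
proof -
  obtain A C where A: "A > 0" and C: "\<And>z. exp (Re (g z / \<mu>)) \<le> C * exp (A * p z)"
    using e unfolding hormander_algebra_iff by auto
  have Cpos: "C > 0"
    using order.strict_trans2[OF exp_gt_zero C, of 0] by (simp add: zero_less_mult_iff)
  have Re: "Re (g z / \<mu>) \<le> ln C + A * p z" for z
  proof -
    have "C * exp (A * p z) = exp (ln C + A * p z)" using Cpos by (simp add: exp_add)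
    with C[of z] show ?thesis by (simp only: exp_le_cancel_iff)
  qed
  obtain K D where K: "K \<ge> 0" and D: "\<And>z. p (2 * z) \<le> K * p z + D"
    using growth_condition_doubling[OF p] by blast
  define f where "f z = (g z - g 0) / \<mu>" for z
  define L where "L = \<bar>ln C\<bar> + cmod (g 0 / \<mu>) + 1"
  have hol: "f holomorphic_on S" for S
    unfolding f_def[abs_def] using g \<open>\<mu> \<noteq> 0\<close>
    by (intro holomorphic_intros) (auto intro: holomorphic_on_subset)
  have bound: "cmod (f z) \<le> 2 * (L + A * p (2 * z))" for z
  proof (cases "z = 0")
    case True
    then show ?thesis
      using A growth_condition_nonneg[OF p] by (simp add: f_def L_def)
  next
    case False
    have "Re (f w) < L + A * p (2 * z)" if w: "cmod w < 2 * cmod z" for w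
    proof -
      have "p w \<le> p (2 * z)"
        using w by (intro growth_condition_mono[OF p]) (simp add: norm_mult)
      then have "A * p w \<le> A * p (2 * z)" using A by simp
      moreover have "Re (f w) = Re (g w / \<mu>) - Re (g 0 / \<mu>)"
        by (simp add: f_def diff_divide_distrib)
      moreover have "\<bar>Re (g 0 / \<mu>)\<bar> \<le> cmod (g 0 / \<mu>)" by (rule abs_Re_le_cmod)
      ultimately show ?thesis using Re[of w] unfolding L_def by linarith
    qed
    then have "(2 * cmod z - cmod z) * cmod (f z) \<le> 2 * (L + A * p (2 * z)) * cmod z"
      using False by (intro Borel_Caratheodory_0 hol) (auto simp: f_def)
    then show ?thesis using False by (simp add: mult.commute)
  qed
  have "cmod (g z) \<le> cmod \<mu> * 2 * A * K * p z + (cmod \<mu> * 2 * (L + A * D) + cmod (g 0))" for z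
  proof -
    have "g z = \<mu> * f z + g 0" using \<open>\<mu> \<noteq> 0\<close> by (simp add: f_def)
    then have "cmod (g z) \<le> cmod \<mu> * cmod (f z) + cmod (g 0)"
      by (metis norm_mult norm_triangle_ineq)
    also have "cmod (f z) \<le> 2 * (L + A * (K * p z + D))"
      by (rule order_trans[OF bound[of z]]) (use A D[of z] in simp)
    finally show ?thesis
      using \<open>\<mu> \<noteq> 0\<close> by (simp add: algebra_simps mult_left_mono)
  qed
  then show ?thesis by blast
qed

lemma exp_in_algebra:
  assumes p: "growth_condition p" and g: "g holomorphic_on UNIV"
    and gr: "\<And>z. cmod (g z) \<le> C * p z + D"
  shows "(\<lambda>z. exp (c * g z)) \<in> hormander_algebra p"
proof -
  have "cmod (exp (c * g z)) \<le> exp (cmod c * D) * exp ((cmod c * \<bar>C\<bar> + 1) * p z)" for z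
  proof -
    have "Re (c * g z) \<le> cmod c * cmod (g z)"
      using complex_Re_le_cmod[of "c * g z"] by (simp add: norm_mult)
    also have "\<dots> \<le> cmod c * (\<bar>C\<bar> * p z + D)"
      using gr[of z] mult_right_mono[OF abs_ge_self[of C] growth_condition_nonneg[OF p, of z]]
      by (intro mult_left_mono) auto
    also have "\<dots> \<le> cmod c * D + (cmod c * \<bar>C\<bar> + 1) * p z"
      using growth_condition_nonneg[OF p, of z] by (simp add: algebra_simps)
    finally show ?thesis by (simp flip: exp_add)
  qed
  moreover have "(\<lambda>z. exp (c * g z)) holomorphic_on UNIV"
    using g by (intro holomorphic_intros)
  moreover have "0 < cmod c * \<bar>C\<bar> + 1" by (simp add: add_nonneg_pos)
  ultimately show ?thesis unfolding hormander_algebra_iff by blast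
qed

section \<open>Symbols dominated by the growth condition\<close>

text \<open>A growth condition has finite order, so Liouville's theorem applies to \<open>g\<close>.\<close>

lemma growth_imp_polynomial:
  assumes p: "growth_condition p" and g: "g holomorphic_on UNIV"
    and gr: "\<And>z. cmod (g z) \<le> C * p z + D"
  shows "\<exists>q. g = poly q"
proof -
  obtain B n where B: "\<And>z. 1 \<le> cmod z \<Longrightarrow> p z \<le> B * cmod z ^ n"
    using growth_condition_polynomial[OF p] by blast
  have "cmod (g z) \<le> (\<bar>C\<bar> * B + \<bar>D\<bar>) * cmod z ^ n" if z: "1 \<le> cmod z" for z
  proof -
    have "C * p z \<le> \<bar>C\<bar> * p z" using growth_condition_nonneg[OF p, of z] by (intro mult_right_mono) auto
    also have "\<dots> \<le> \<bar>C\<bar> * (B * cmod z ^ n)" using B[OF z] by (intro mult_left_mono) auto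
    finally have "C * p z \<le> \<bar>C\<bar> * (B * cmod z ^ n)" .
    moreover have "\<bar>D\<bar> * 1 \<le> \<bar>D\<bar> * cmod z ^ n"
      using z by (intro mult_left_mono) (auto intro: one_le_power)
    ultimately show ?thesis using gr[of z] by (simp add: algebra_simps)
  qed
  from Liouville_polynomial[OF g this]
  have "g = poly (\<Sum>k\<le>n. monom ((deriv ^^ k) g 0 / fact k) k)"
    by (auto simp: poly_sum poly_monom)
  then show ?thesis by blast
qed

lemma nonconstant_poly_lower_bound:
  fixes q :: "complex poly"
  assumes "\<not> poly q constant_on UNIV"
  obtains c R a where "c > 0" "\<And>z. R \<le> cmod z \<Longrightarrow> c * cmod z \<le> cmod (poly q z) + a"
proof -
  obtain b s where q: "q = pCons b s" by (cases q)
  have "s \<noteq> 0" using assms by (auto simp: q constant_on_def)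
  obtain d u where s: "s = pCons d u" by (cases s)
  have "\<exists>c>0. \<exists>R. \<forall>z. R \<le> cmod z \<longrightarrow> c \<le> cmod (poly s z)"
  proof (cases "u = 0")
    case True
    then show ?thesis using \<open>s \<noteq> 0\<close> by (auto simp: s intro!: exI[of _ "cmod d"])
  next
    case False
    then obtain R where "\<forall>z. R \<le> cmod z \<longrightarrow> 1 \<le> cmod (poly s z)"
      using poly_infinity[of u 1 d] unfolding s by blast
    then show ?thesis using zero_less_one by blast
  qed
  then obtain c R where c: "c > 0" "\<And>z. R \<le> cmod z \<Longrightarrow> c \<le> cmod (poly s z)" by blast
  have "c * cmod z \<le> cmod (poly q z) + cmod b" if "R \<le> cmod z" for z
  proof -
    have "c * cmod z \<le> cmod (poly s z) * cmod z"
      using c(2)[OF that] by (intro mult_right_mono) auto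
    also have "\<dots> = cmod (poly q z - b)" by (simp add: q norm_mult)
    also have "\<dots> \<le> cmod (poly q z) + cmod b" by (rule norm_triangle_ineq4)
    finally show ?thesis .
  qed
  with c(1) show ?thesis by (rule that)
qed

lemma growth_imp_id_bigo:
  assumes p: "growth_condition p" and q: "\<not> poly q constant_on UNIV"
    and gr: "\<And>z. cmod (poly q z) \<le> C * p z + D"
  shows "(\<lambda>r. r) \<in> O[at_top](\<lambda>r. p (complex_of_real r))"
proof -
  obtain c R a where c: "c > 0" and R: "\<And>z. R \<le> cmod z \<Longrightarrow> c * cmod z \<le> cmod (poly q z) + a"
    using nonconstant_poly_lower_bound[OF q] by blast
  show ?thesis
  proof (rule bigo_growth_conditionI[OF p])
    fix r :: real assume r: "0 \<le> r"
    show "r \<le> \<bar>C\<bar> / c * p (complex_of_real r) + (\<bar>D + a\<bar> / c + \<bar>R\<bar>)"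
    proof (cases "R \<le> r")
      case True
      have "C * p (complex_of_real r) \<le> \<bar>C\<bar> * p (complex_of_real r)"
        using growth_condition_nonneg[OF p] by (intro mult_right_mono) auto
      then have "c * r \<le> \<bar>C\<bar> * p (complex_of_real r) + \<bar>D + a\<bar>"
        using R[of "complex_of_real r"] gr[of "complex_of_real r"] r True by simp
      then have "r \<le> (\<bar>C\<bar> * p (complex_of_real r) + \<bar>D + a\<bar>) / c"
        using c by (simp add: field_simps)
      also have "\<dots> \<le> \<bar>C\<bar> / c * p (complex_of_real r) + (\<bar>D + a\<bar> / c + \<bar>R\<bar>)"
        by (simp add: add_divide_distrib)
      finally show ?thesis .
    next
      case False
      have "0 \<le> \<bar>C\<bar> / c * p (complex_of_real r) + \<bar>D + a\<bar> / c"
        using c growth_condition_nonneg[OF p] by simp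
      with False show ?thesis by linarith
    qed
  qed
qed

section \<open>The Volterra operator on entire functions\<close>

lemma volterra_derivative:
  assumes f: "f holomorphic_on UNIV" and g: "g holomorphic_on UNIV"
  shows "(volterra g f has_field_derivative f z * deriv g z) (at z)"
proof -
  have "(\<lambda>\<zeta>. f \<zeta> * deriv g \<zeta>) holomorphic_on UNIV"
    using f g by (intro holomorphic_intros) auto
  then obtain G where G: "\<And>z. (G has_field_derivative f z * deriv g z) (at z)"
    using holomorphic_convex_primitive'[of UNIV "\<lambda>\<zeta>. f \<zeta> * deriv g \<zeta>"] by auto
  have "volterra g f z = G z - G 0" for z
  proof -
    have "((\<lambda>\<zeta>. f \<zeta> * deriv g \<zeta>) has_contour_integral
        (G (pathfinish (linepath 0 z)) - G (pathstart (linepath 0 z)))) (linepath 0 z)"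
      by (intro contour_integral_primitive[of UNIV] valid_path_linepath
          has_field_derivative_at_within[OF G]) simp
    then show ?thesis unfolding volterra_def by (simp add: contour_integral_unique)
  qed
  then have "volterra g f = (\<lambda>z. G z - G 0)" by auto
  then show ?thesis using G[of z] by (auto intro!: derivative_eq_intros)
qed

lemma volterra_0 [simp]: "volterra g f 0 = 0"
  by (simp add: volterra_def)

lemma volterra_holomorphic:
  assumes "f holomorphic_on UNIV" "g holomorphic_on UNIV"
  shows "volterra g f holomorphic_on UNIV"
  using volterra_derivative[OF assms] by (auto simp: holomorphic_on_open)

lemma volterra_unique:
  assumes f: "f holomorphic_on UNIV" and g: "g holomorphic_on UNIV" and "F 0 = 0"
    and F: "\<And>z. (F has_field_derivative f z * deriv g z) (at z)"
  shows "volterra g f = F"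
proof
  fix z
  have "((\<lambda>z. volterra g f z - F z) has_field_derivative 0) (at z within UNIV)" for z
    using volterra_derivative[OF f g] F by (auto intro!: derivative_eq_intros)
  then obtain c where "\<And>z. volterra g f z - F z = c"
    using has_field_derivative_zero_constant[of UNIV "\<lambda>z. volterra g f z - F z"] by auto
  from this[of z] this[of 0] show "volterra g f z = F z" using \<open>F 0 = 0\<close> by simp
qed

lemma volterra_lincomb:
  assumes f: "f holomorphic_on UNIV" and h: "h holomorphic_on UNIV" and g: "g holomorphic_on UNIV"
  shows "volterra g (\<lambda>z. a * f z + b * h z) = (\<lambda>z. a * volterra g f z + b * volterra g h z)"
proof (rule volterra_unique[OF _ g])
  show "(\<lambda>z. a * f z + b * h z) holomorphic_on UNIV" using f h by (intro holomorphic_intros)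
  show "((\<lambda>z. a * volterra g f z + b * volterra g h z) has_field_derivative
      (a * f z + b * h z) * deriv g z) (at z)" for z
    by (auto intro!: derivative_eq_intros volterra_derivative f g h simp: algebra_simps)
qed simp

text \<open>
  Differentiating \<open>V f - \<mu> * f = k\<close> gives \<open>\<mu> * f' = f * g'\<close>, whose solutions are the multiples of
  \<open>exp (g / \<mu>)\<close>; the value at \<open>0\<close> picks out the multiple. With \<open>k = 0\<close> this says that \<open>\<mu>\<close> is not an
  eigenvalue, and with \<open>k = 1\<close> it identifies the only possible preimage of the function \<open>1\<close>.
\<close>

lemma volterra_resolvent_const:
  assumes f: "f holomorphic_on UNIV" and g: "g holomorphic_on UNIV" and \<mu>: "\<mu> \<noteq> 0"
    and eq: "\<And>z. volterra g f z - \<mu> * f z = k"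
  shows "f z = - (k / \<mu>) * exp (- (g 0 / \<mu>)) * exp (g z / \<mu>)"
proof -
  have f_eq: "f = (\<lambda>z. (volterra g f z - k) / \<mu>)"
    using eq \<mu> by (auto simp: fun_eq_iff field_simps)
  have f': "(f has_field_derivative f z * deriv g z / \<mu>) (at z)" for z
    by (subst f_eq) (auto intro!: derivative_eq_intros volterra_derivative f g simp: \<mu>)
  have g': "(g has_field_derivative deriv g z) (at z)" for z
    using g by (intro holomorphic_derivI[of g UNIV]) auto
  have "((\<lambda>z. f z * exp (- (g z / \<mu>))) has_field_derivative 0) (at z within UNIV)" for z
    using \<mu> by (auto intro!: derivative_eq_intros f' g' simp: field_simps)
  then obtain c where c: "\<And>z. f z * exp (- (g z / \<mu>)) = c"
    using has_field_derivative_zero_constant[of UNIV "\<lambda>z. f z * exp (- (g z / \<mu>))"] by auto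
  have "f 0 = - (k / \<mu>)" using eq[of 0] \<mu> by (auto simp: field_simps)
  then have "f z * exp (- (g z / \<mu>)) = - (k / \<mu>) * exp (- (g 0 / \<mu>))"
    using c[of z] c[of 0] by simp
  then have "f z * exp (- (g z / \<mu>)) * exp (g z / \<mu>) = - (k / \<mu>) * exp (- (g 0 / \<mu>)) * exp (g z / \<mu>)"
    by simp
  then show ?thesis by (simp add: mult.assoc flip: exp_add)
qed

text \<open>
  Variation of constants for \<open>V f - \<mu> * f = h\<close>, with the term containing \<open>h'\<close> integrated by parts.
  In this form the inverse of \<open>V - \<mu>\<close> is built from multiplications by \<open>exp (\<plusminus> g / \<mu>)\<close> and from \<open>V\<close>
  itself, so that no estimate for \<open>h'\<close> is called for.
\<close>

definition volterra_resolvent ::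
  "(complex \<Rightarrow> complex) \<Rightarrow> complex \<Rightarrow> (complex \<Rightarrow> complex) \<Rightarrow> complex \<Rightarrow> complex" where
  "volterra_resolvent g \<mu> h = (\<lambda>z. - 1 / \<mu> * h z +
     - 1 / \<mu>\<^sup>2 * (exp (1 / \<mu> * g z) * volterra g (\<lambda>w. exp (- 1 / \<mu> * g w) * h w) z))"

lemma volterra_resolvent_eq:
  assumes h: "h holomorphic_on UNIV" and g: "g holomorphic_on UNIV" and \<mu>: "\<mu> \<noteq> 0"
  shows "volterra g (volterra_resolvent g \<mu> h) z - \<mu> * volterra_resolvent g \<mu> h z = h z"
proof -
  define u where "u = volterra g (\<lambda>w. exp (- 1 / \<mu> * g w) * h w)"
  have eh: "(\<lambda>w. exp (- 1 / \<mu> * g w) * h w) holomorphic_on UNIV"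
    using g h by (intro holomorphic_intros)
  have u': "(u has_field_derivative exp (- 1 / \<mu> * g z) * h z * deriv g z) (at z)" for z
    unfolding u_def by (rule volterra_derivative[OF eh g])
  have g': "(g has_field_derivative deriv g z) (at z)" for z
    using g by (intro holomorphic_derivI[of g UNIV]) auto
  have R: "volterra_resolvent g \<mu> h = (\<lambda>z. - 1 / \<mu> * h z + - 1 / \<mu>\<^sup>2 * (exp (1 / \<mu> * g z) * u z))"
    by (simp add: volterra_resolvent_def u_def)
  have uh: "u holomorphic_on UNIV"
    unfolding u_def by (rule volterra_holomorphic[OF eh g])
  have "volterra g (volterra_resolvent g \<mu> h) = (\<lambda>z. - 1 / \<mu> * (exp (1 / \<mu> * g z) * u z))"
  proof (rule volterra_unique[OF _ g])
    show "volterra_resolvent g \<mu> h holomorphic_on UNIV"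
      unfolding R using g h uh \<mu> by (intro holomorphic_intros) auto
    show "- 1 / \<mu> * (exp (1 / \<mu> * g 0) * u 0) = 0" by (simp add: u_def)
    fix z
    have inv: "exp (1 / \<mu> * g z) * exp (- 1 / \<mu> * g z) = 1"
      by (simp flip: exp_add)
    have "((\<lambda>z. - 1 / \<mu> * (exp (1 / \<mu> * g z) * u z)) has_field_derivative
        - 1 / \<mu> * (exp (1 / \<mu> * g z) * (1 / \<mu> * deriv g z) * u z
          + (exp (1 / \<mu> * g z) * exp (- 1 / \<mu> * g z)) * (h z * deriv g z))) (at z)"
      by (rule derivative_eq_intros u' g' refl)+ (simp add: algebra_simps)
    then show "((\<lambda>z. - 1 / \<mu> * (exp (1 / \<mu> * g z) * u z)) has_field_derivative
        volterra_resolvent g \<mu> h z * deriv g z) (at z)"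
      unfolding inv R by (simp add: algebra_simps power2_eq_square)
  qed
  then show ?thesis using \<mu> by (simp add: R power2_eq_square field_simps)
qed

section \<open>Continuity in the inductive limit topology\<close>

text \<open>
  For linear \<open>T\<close> this says that \<open>T\<close> maps the step with parameter \<open>A\<close> into the one with parameter
  \<open>B\<close>, with operator norm at most \<open>K\<close>. Explicit majorants \<open>C * exp (A * p z)\<close> in place of the step
  norms make composites and linear combinations easy to estimate.
\<close>

definition step_bound ::
  "(complex \<Rightarrow> real) \<Rightarrow> ((complex \<Rightarrow> complex) \<Rightarrow> complex \<Rightarrow> complex) \<Rightarrow> real \<Rightarrow> real \<Rightarrow> real \<Rightarrow> bool" where
  "step_bound p T A B K \<longleftrightarrow> (\<forall>f C.
     f holomorphic_on UNIV \<longrightarrow> (\<forall>z. cmod (f z) \<le> C * exp (A * p z)) \<longrightarrow>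
     T f holomorphic_on UNIV \<and> (\<forall>z. cmod (T f z) \<le> K * C * exp (B * p z)))"

definition step_bounded ::
  "(complex \<Rightarrow> real) \<Rightarrow> ((complex \<Rightarrow> complex) \<Rightarrow> complex \<Rightarrow> complex) \<Rightarrow> bool" where
  "step_bounded p T \<longleftrightarrow> (\<forall>A>0. \<exists>B>0. \<exists>K\<ge>0. step_bound p T A B K)"

lemma step_boundI:
  assumes "\<And>f C. f holomorphic_on UNIV \<Longrightarrow> (\<And>z. cmod (f z) \<le> C * exp (A * p z)) \<Longrightarrow> C \<ge> 0 \<Longrightarrow>
      T f holomorphic_on UNIV"
    and "\<And>f C z. f holomorphic_on UNIV \<Longrightarrow> (\<And>z. cmod (f z) \<le> C * exp (A * p z)) \<Longrightarrow> C \<ge> 0 \<Longrightarrow>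
      cmod (T f z) \<le> K * C * exp (B * p z)"
  shows "step_bound p T A B K"
  unfolding step_bound_def
proof (intro allI impI)
  fix f C assume f: "f holomorphic_on UNIV" "\<forall>z. cmod (f z) \<le> C * exp (A * p z)"
  have "0 \<le> C * exp (A * p 0)" using f(2) order_trans[OF norm_ge_zero] by blast
  then have "C \<ge> 0" by (simp add: zero_le_mult_iff)
  then show "T f holomorphic_on UNIV \<and> (\<forall>z. cmod (T f z) \<le> K * C * exp (B * p z))"
    using assms(1)[of f C] assms(2)[of f C] f by simp
qed

lemma step_boundD:
  assumes "step_bound p T A B K" "f holomorphic_on UNIV" "\<And>z. cmod (f z) \<le> C * exp (A * p z)"
  shows "T f holomorphic_on UNIV" "cmod (T f z) \<le> K * C * exp (B * p z)"
  using assms unfolding step_bound_def by blast+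

lemma step_boundedE:
  assumes "step_bounded p T" "A > 0"
  obtains B K where "B > 0" "K \<ge> 0" "step_bound p T A B K"
  using assms unfolding step_bounded_def by blast

lemma step_bounded_algebra:
  assumes T: "step_bounded p T" and f: "f \<in> hormander_algebra p"
  shows "T f \<in> hormander_algebra p"
proof -
  obtain A C where A: "A > 0" and f: "f holomorphic_on UNIV" "\<And>z. cmod (f z) \<le> C * exp (A * p z)"
    using f unfolding hormander_algebra_iff by blast
  obtain B K where B: "B > 0" "step_bound p T A B K"
    using step_boundedE[OF T A] by blast
  show ?thesis
    unfolding hormander_algebra_iff using B(1) step_boundD[OF B(2) f] by blast
qed

lemma step_bounded_compose:
  assumes S: "step_bounded p S" and T: "step_bounded p T"
  shows "step_bounded p (\<lambda>f. S (T f))"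
  unfolding step_bounded_def
proof (intro allI impI)
  fix A :: real assume "A > 0"
  obtain B K where B: "B > 0" "K \<ge> 0" "step_bound p T A B K"
    using step_boundedE[OF T \<open>A > 0\<close>] by blast
  obtain B' K' where B': "B' > 0" "K' \<ge> 0" "step_bound p S B B' K'"
    using step_boundedE[OF S \<open>B > 0\<close>] by blast
  have "step_bound p (\<lambda>f. S (T f)) A B' (K' * K)"
  proof (rule step_boundI)
    fix f C z assume f: "f holomorphic_on UNIV" "\<And>z. cmod (f z) \<le> C * exp (A * p z)"
    note Tf = step_boundD[OF B(3) f]
    show "S (T f) holomorphic_on UNIV" by (rule step_boundD(1)[OF B'(3) Tf])
    show "cmod (S (T f) z) \<le> K' * K * C * exp (B' * p z)"
      using step_boundD(2)[OF B'(3) Tf] by (simp add: mult.assoc)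
  qed
  moreover have "K' * K \<ge> 0" using B(2) B'(2) by simp
  ultimately show "\<exists>B>0. \<exists>K\<ge>0. step_bound p (\<lambda>f. S (T f)) A B K" using B'(1) by blast
qed

lemma step_bounded_mult:
  assumes "u \<in> hormander_algebra p"
  shows "step_bounded p (\<lambda>f z. u z * f z)"
  unfolding step_bounded_def
proof (intro allI impI)
  fix A :: real assume "A > 0"
  obtain B K where B: "B > 0" "u holomorphic_on UNIV" "\<And>z. cmod (u z) \<le> K * exp (B * p z)"
    using assms unfolding hormander_algebra_iff by blast
  have "0 \<le> K * exp (B * p 0)" using order_trans[OF norm_ge_zero B(3)] .
  then have "K \<ge> 0" by (simp add: zero_le_mult_iff)
  have "step_bound p (\<lambda>f z. u z * f z) A (A + B) K"
  proof (rule step_boundI)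
    fix f C z assume f: "f holomorphic_on UNIV" "\<And>z. cmod (f z) \<le> C * exp (A * p z)"
    show "(\<lambda>z. u z * f z) holomorphic_on UNIV" using B(2) f(1) by (intro holomorphic_intros)
    have "cmod (u z * f z) \<le> (K * exp (B * p z)) * (C * exp (A * p z))"
      unfolding norm_mult using \<open>K \<ge> 0\<close> by (intro mult_mono B(3) f(2)) auto
    then show "cmod (u z * f z) \<le> K * C * exp ((A + B) * p z)"
      by (simp add: exp_add algebra_simps)
  qed
  then show "\<exists>B>0. \<exists>K\<ge>0. step_bound p (\<lambda>f z. u z * f z) A B K"
    using add_pos_pos[OF \<open>A > 0\<close> \<open>B > 0\<close>] \<open>K \<ge> 0\<close> by blast
qed

lemma step_bounded_lincomb:
  assumes p: "growth_condition p" and S: "step_bounded p S" and T: "step_bounded p T"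
  shows "step_bounded p (\<lambda>f z. a * S f z + b * T f z)"
  unfolding step_bounded_def
proof (intro allI impI)
  fix A :: real assume "A > 0"
  obtain B K where B: "B > 0" "K \<ge> 0" "step_bound p S A B K"
    using step_boundedE[OF S \<open>A > 0\<close>] by blast
  obtain B' K' where B': "B' > 0" "K' \<ge> 0" "step_bound p T A B' K'"
    using step_boundedE[OF T \<open>A > 0\<close>] by blast
  have "step_bound p (\<lambda>f z. a * S f z + b * T f z) A (B + B') (cmod a * K + cmod b * K')"
  proof (rule step_boundI)
    fix f C z assume f: "f holomorphic_on UNIV" "\<And>z. cmod (f z) \<le> C * exp (A * p z)" and "C \<ge> 0"
    note Sf = step_boundD[OF B(3) f] and Tf = step_boundD[OF B'(3) f]
    show "(\<lambda>z. a * S f z + b * T f z) holomorphic_on UNIV"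
      by (intro holomorphic_intros Sf(1) Tf(1))
    have "exp (B * p z) \<le> exp ((B + B') * p z)" "exp (B' * p z) \<le> exp ((B + B') * p z)"
      using \<open>B > 0\<close> \<open>B' > 0\<close> growth_condition_nonneg[OF p, of z] by (simp_all add: mult_right_mono)
    then have "K * C * exp (B * p z) \<le> K * C * exp ((B + B') * p z)"
      "K' * C * exp (B' * p z) \<le> K' * C * exp ((B + B') * p z)"
      using \<open>K \<ge> 0\<close> \<open>K' \<ge> 0\<close> \<open>C \<ge> 0\<close> by (intro mult_left_mono; simp)+
    then have "cmod (S f z) \<le> K * C * exp ((B + B') * p z)"
      "cmod (T f z) \<le> K' * C * exp ((B + B') * p z)"
      using Sf(2)[of z] Tf(2)[of z] by linarith+
    then have "cmod a * cmod (S f z) + cmod b * cmod (T f z) \<le>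
        cmod a * (K * C * exp ((B + B') * p z)) + cmod b * (K' * C * exp ((B + B') * p z))"
      by (intro add_mono mult_left_mono) auto
    then have "cmod (a * S f z + b * T f z) \<le>
        cmod a * (K * C * exp ((B + B') * p z)) + cmod b * (K' * C * exp ((B + B') * p z))"
      using norm_triangle_ineq[of "a * S f z" "b * T f z"] unfolding norm_mult by linarith
    also have "\<dots> = (cmod a * K + cmod b * K') * C * exp ((B + B') * p z)"
      by (simp only: distrib_right mult.assoc)
    finally show "cmod (a * S f z + b * T f z) \<le>
        (cmod a * K + cmod b * K') * C * exp ((B + B') * p z)" .
  qed
  moreover have "cmod a * K + cmod b * K' \<ge> 0" using B(2) B'(2) by simp
  ultimately show "\<exists>B>0. \<exists>K\<ge>0. step_bound p (\<lambda>f z. a * S f z + b * T f z) A B K"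
    using add_pos_pos[OF B(1) B'(1)] by blast
qed

lemma step_bounded_ident: "step_bounded p (\<lambda>f. f)"
proof -
  have "step_bound p (\<lambda>f. f) A A 1" for A by (rule step_boundI) simp_all
  then show ?thesis unfolding step_bounded_def using zero_le_one by blast
qed

lemma step_bounded_volterra:
  assumes p: "growth_condition p" and g: "g holomorphic_on UNIV"
    and g': "deriv g \<in> hormander_algebra p"
  shows "step_bounded p (volterra g)"
  unfolding step_bounded_def
proof (intro allI impI)
  fix A :: real assume "A > 0"
  obtain B D where B: "B > 0" "\<And>z. cmod (deriv g z) \<le> D * exp (B * p z)"
    using g' unfolding hormander_algebra_iff by blast
  have "0 \<le> D * exp (B * p 0)" using order_trans[OF norm_ge_zero B(2)] .
  then have "D \<ge> 0" by (simp add: zero_le_mult_iff)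
  obtain K where K: "\<And>z. cmod z \<le> K * exp (p z)"
    using growth_condition_exp_ge[OF p] by blast
  have "0 \<le> K * exp (p 0)" using order_trans[OF norm_ge_zero K] .
  then have "K \<ge> 0" by (simp add: zero_le_mult_iff)
  have "step_bound p (volterra g) A (A + B + 1) (D * K)"
  proof (rule step_boundI)
    fix f C z assume f: "f holomorphic_on UNIV" "\<And>z. cmod (f z) \<le> C * exp (A * p z)" and "C \<ge> 0"
    show "volterra g f holomorphic_on UNIV" by (rule volterra_holomorphic[OF f(1) g])
    have hol: "(\<lambda>\<zeta>. f \<zeta> * deriv g \<zeta>) holomorphic_on UNIV"
      using f(1) g by (intro holomorphic_intros) auto
    \<comment> \<open>On the segment from \<open>0\<close> to \<open>z\<close> the weight is at most its value at \<open>z\<close>.\<close>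
    have seg: "cmod (f w * deriv g w) \<le> (C * exp (A * p z)) * (D * exp (B * p z))"
      if "w \<in> closed_segment 0 z" for w
    proof -
      have "p w \<le> p z"
        using segment_bound1[OF that] by (intro growth_condition_mono[OF p]) simp
      then have "C * exp (A * p w) \<le> C * exp (A * p z)" "D * exp (B * p w) \<le> D * exp (B * p z)"
        using \<open>A > 0\<close> \<open>B > 0\<close> \<open>C \<ge> 0\<close> \<open>D \<ge> 0\<close> by (intro mult_left_mono; simp)+
      then have "cmod (f w) \<le> C * exp (A * p z)" "cmod (deriv g w) \<le> D * exp (B * p z)"
        using f(2)[of w] B(2)[of w] by linarith+
      then show ?thesis unfolding norm_mult using \<open>C \<ge> 0\<close> by (intro mult_mono) auto
    qed
    have "cmod (volterra g f z) \<le> (C * exp (A * p z)) * (D * exp (B * p z)) * cmod (z - 0)"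
      unfolding volterra_def
    proof (rule contour_integral_bound_linepath[OF _ _ seg])
      show "(\<lambda>\<zeta>. f \<zeta> * deriv g \<zeta>) contour_integrable_on linepath 0 z"
        using hol by (intro contour_integrable_continuous_linepath
            holomorphic_on_imp_continuous_on) (auto intro: holomorphic_on_subset)
    qed (use \<open>C \<ge> 0\<close> \<open>D \<ge> 0\<close> in auto)
    also have "\<dots> \<le> (C * exp (A * p z)) * (D * exp (B * p z)) * (K * exp (p z))"
      using K[of z] \<open>C \<ge> 0\<close> \<open>D \<ge> 0\<close> by (intro mult_left_mono) auto
    also have "\<dots> = D * K * C * exp ((A + B + 1) * p z)"
      by (simp add: exp_add algebra_simps)
    finally show "cmod (volterra g f z) \<le> D * K * C * exp ((A + B + 1) * p z)" .
  qed
  moreover have "A + B + 1 > 0" "D * K \<ge> 0"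
    using \<open>A > 0\<close> \<open>B > 0\<close> \<open>D \<ge> 0\<close> \<open>K \<ge> 0\<close> by auto
  ultimately show "\<exists>B>0. \<exists>K\<ge>0. step_bound p (volterra g) A B K" by blast
qed

text \<open>
  The preimage of a basic neighbourhood of \<open>0\<close> is absolutely convex by linearity and meets every
  step in a neighbourhood of \<open>0\<close> by boundedness on steps, so it is again a basic neighbourhood.
\<close>

lemma step_bounded_continuous_map:
  assumes p: "growth_condition p" and T: "step_bounded p T"
    and lin: "\<And>f h a b. f \<in> hormander_algebra p \<Longrightarrow> h \<in> hormander_algebra p \<Longrightarrow>
      T (\<lambda>z. a * f z + b * h z) = (\<lambda>z. a * T f z + b * T h z)"
  shows "continuous_map (hormander_topology p) (hormander_topology p) T"
proof -
  let ?X = "hormander_topology p" and ?A = "hormander_algebra p"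
  have space: "topspace ?X = ?A"
    by (rule topspace_hormander_topology) (rule growth_condition_nonneg[OF p])
  have preimage: "inductive_nhd0 p {h \<in> ?A. T h \<in> W}" if W: "inductive_nhd0 p W" for W
    unfolding inductive_nhd0_def
  proof (intro conjI allI impI)
    show "{h \<in> ?A. T h \<in> W} \<subseteq> ?A" by auto
    have "absolutely_convex W" using W by (simp add: inductive_nhd0_def)
    then show "absolutely_convex {h \<in> ?A. T h \<in> W}"
      unfolding absolutely_convex_def
      by (auto simp: lin intro!: growth_condition_algebra_lincomb[OF p])
    fix A :: real assume "A > 0"
    obtain B K where B: "B > 0" "K \<ge> 0" "step_bound p T A B K"
      using step_boundedE[OF T \<open>A > 0\<close>] by blast
    obtain e where e: "e > 0" "\<And>f. f \<in> hormander_step p B \<Longrightarrow> hormander_norm p B f < e \<Longrightarrow> f \<in> W"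
      using W \<open>B > 0\<close> unfolding inductive_nhd0_def by blast
    show "\<exists>d>0. \<forall>f\<in>hormander_step p A. hormander_norm p A f < d \<longrightarrow> f \<in> {h \<in> ?A. T h \<in> W}"
    proof (intro exI[of _ "e / (K + 1)"] conjI ballI impI)
      show "0 < e / (K + 1)" using e(1) B(2) by simp
      fix f assume f: "f \<in> hormander_step p A" and small: "hormander_norm p A f < e / (K + 1)"
      define N where "N = hormander_norm p A f"
      have hol: "f holomorphic_on UNIV" using f by (simp add: hormander_step_def)
      have N: "cmod (f z) \<le> N * exp (A * p z)" for z
      proof -
        have "cmod (f z) * exp (- A * p z) \<le> N"
          unfolding N_def hormander_norm_def using f
          by (intro cSUP_upper) (auto simp: hormander_step_def)
        then show ?thesis by (simp add: exp_minus field_simps)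
      qed
      have "0 \<le> N * exp (A * p 0)" using order_trans[OF norm_ge_zero N] .
      then have "N \<ge> 0" by (simp add: zero_le_mult_iff)
      have bd: "cmod (T f z) \<le> K * N * exp (B * p z)" for z by (rule step_boundD(2)[OF B(3) hol N])
      have "hormander_norm p B (T f) \<le> K * N"
        unfolding hormander_norm_def using bd
        by (intro cSUP_least) (auto simp: exp_minus field_simps)
      also have "\<dots> \<le> (K + 1) * N" using \<open>N \<ge> 0\<close> by (simp add: algebra_simps)
      also have "\<dots> < e" using small B(2) unfolding N_def by (simp add: field_simps)
      finally have "hormander_norm p B (T f) < e" .
      moreover have "T f \<in> hormander_step p B"
        unfolding hormander_step_iff using step_boundD(1)[OF B(3) hol N] bd by blast
      ultimately have "T f \<in> W" by (intro e(2))
      moreover have "f \<in> ?A" using f \<open>A > 0\<close> by (auto simp: hormander_algebra_def)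
      ultimately show "f \<in> {h \<in> ?A. T h \<in> W}" by simp
    qed
  qed
  show ?thesis
    unfolding continuous_map_def
  proof (intro conjI allI impI)
    show "T \<in> topspace ?X \<rightarrow> topspace ?X"
      using step_bounded_algebra[OF T] by (auto simp: space)
    fix U assume U: "openin ?X U"
    show "openin ?X {x \<in> topspace ?X. T x \<in> U}"
      unfolding openin_hormander_topology space
    proof (intro conjI ballI)
      fix f assume f: "f \<in> {x \<in> ?A. T x \<in> U}"
      obtain W where W: "inductive_nhd0 p W" "\<forall>h\<in>W. (\<lambda>z. T f z + h z) \<in> U"
        using U f unfolding openin_hormander_topology by blast
      have "(\<lambda>z. f z + h z) \<in> {x \<in> ?A. T x \<in> U}" if h: "h \<in> {h \<in> ?A. T h \<in> W}" for h
      proof -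
        have "T (\<lambda>z. f z + h z) = (\<lambda>z. T f z + T h z)"
          using lin[of f h, where a = 1 and b = 1] f h by simp
        moreover have "(\<lambda>z. f z + h z) \<in> ?A"
          using growth_condition_algebra_lincomb[OF p, of f h, where a = 1 and b = 1] f h by simp
        ultimately show ?thesis using W(2) h by simp
      qed
      with preimage[OF W(1)]
      show "\<exists>W. inductive_nhd0 p W \<and> (\<forall>h\<in>W. (\<lambda>z. f z + h z) \<in> {x \<in> ?A. T x \<in> U})"
        by blast
    qed auto
  qed
qed

section \<open>The spectrum\<close>

lemma zero_in_spectrum_volterra:
  assumes p: "growth_condition p"
  shows "0 \<in> spectrum (hormander_topology p) (volterra g)"
proof (rule ccontr)
  assume "0 \<notin> spectrum (hormander_topology p) (volterra g)"
  then have "bij_betw (\<lambda>f z. volterra g f z - 0 * f z) (hormander_algebra p) (hormander_algebra p)"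
    by (simp add: spectrum_def resolvent_set_def Let_def
        topspace_hormander_topology growth_condition_nonneg[OF p])
  then obtain f where "(\<lambda>z. 1) = (\<lambda>z. volterra g f z - 0 * f z)"
    using hormander_algebra_const[OF p, of 1] unfolding bij_betw_def by blast
  from fun_cong[OF this, of 0] show False by simp
qed

lemma resolvent_imp_exp_in_algebra:
  assumes p: "growth_condition p" and g: "g holomorphic_on UNIV" and \<mu>: "\<mu> \<noteq> 0"
    and "\<mu> \<notin> spectrum (hormander_topology p) (volterra g)"
  shows "(\<lambda>z. exp (g z / \<mu>)) \<in> hormander_algebra p"
proof -
  have "bij_betw (\<lambda>f z. volterra g f z - \<mu> * f z) (hormander_algebra p) (hormander_algebra p)"
    using assms(4) by (simp add: spectrum_def resolvent_set_def Let_def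
        topspace_hormander_topology growth_condition_nonneg[OF p])
  then obtain f where f: "f \<in> hormander_algebra p" "(\<lambda>z. 1) = (\<lambda>z. volterra g f z - \<mu> * f z)"
    using hormander_algebra_const[OF p, of 1] unfolding bij_betw_def by blast
  have hol: "f holomorphic_on UNIV" using f(1) by (simp add: hormander_algebra_iff)
  have "f z = - (1 / \<mu>) * exp (- (g 0 / \<mu>)) * exp (g z / \<mu>)" for z
    using fun_cong[OF f(2)] by (intro volterra_resolvent_const[OF hol g \<mu>]) simp
  then have eq: "(\<lambda>z. exp (g z / \<mu>)) = (\<lambda>z. (- \<mu> * exp (g 0 / \<mu>)) * f z)"
    using \<mu> by (simp add: exp_minus fun_eq_iff)
  show ?thesis
    unfolding eq by (rule hormander_algebra_mult[OF hormander_algebra_const[OF p] f(1)])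
qed

text \<open>
  When \<open>cmod (g z)\<close> is dominated by \<open>p\<close>, both \<open>exp (g / \<mu>)\<close> and \<open>exp (- g / \<mu>)\<close> are multipliers of
  the algebra. The symbol is a polynomial, hence so is its derivative, and \<open>V\<close> is bounded on steps.
  The variation of constants formula composes these operators, so it inverts \<open>V - \<mu>\<close> continuously.
\<close>

lemma growth_imp_in_resolvent_set:
  assumes p: "growth_condition p" and g: "g holomorphic_on UNIV" and \<mu>: "\<mu> \<noteq> 0"
    and gr: "\<And>z. cmod (g z) \<le> C * p z + D"
  shows "\<mu> \<notin> spectrum (hormander_topology p) (volterra g)"
proof -
  let ?X = "hormander_topology p" and ?A = "hormander_algebra p"
  let ?R = "volterra_resolvent g \<mu>" and ?S = "\<lambda>f z. volterra g f z - \<mu> * f z"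
  have space: "topspace ?X = ?A"
    by (rule topspace_hormander_topology) (rule growth_condition_nonneg[OF p])
  have hol: "f holomorphic_on UNIV" if "f \<in> ?A" for f
    using that by (simp add: hormander_algebra_iff)
  obtain q where q: "g = poly q"
    using growth_imp_polynomial[OF p g gr] by blast
  have "deriv g = poly (pderiv q)"
    unfolding q by (intro ext DERIV_imp_deriv poly_DERIV)
  then have V: "step_bounded p (volterra g)"
    using hormander_algebra_poly[OF p] by (intro step_bounded_volterra[OF p g]) simp
  have E: "step_bounded p (\<lambda>f z. exp (c * g z) * f z)" for c
    by (rule step_bounded_mult[OF exp_in_algebra[OF p g gr]])
  have R: "step_bounded p ?R"
    unfolding volterra_resolvent_def
    by (rule step_bounded_lincomb[OF p step_bounded_ident
          step_bounded_compose[OF E step_bounded_compose[OF V E]]])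
  have S: "?S f \<in> ?A" if "f \<in> ?A" for f
    using growth_condition_algebra_lincomb[OF p
        step_bounded_algebra[OF V that] that, of 1 "- \<mu>"] by simp
  have SR: "?S (?R h) = h" if "h \<in> ?A" for h
    using volterra_resolvent_eq[OF hol[OF that] g \<mu>] by auto
  have inj: "inj_on ?S ?A"
  proof (rule inj_onI)
    fix f h assume f: "f \<in> ?A" and h: "h \<in> ?A" and eq: "?S f = ?S h"
    define d where "d = (\<lambda>z. 1 * f z + (- 1) * h z)"
    have "d \<in> ?A" unfolding d_def
      by (rule growth_condition_algebra_lincomb[OF p f h])
    have "volterra g d = (\<lambda>z. 1 * volterra g f z + (- 1) * volterra g h z)"
      unfolding d_def by (rule volterra_lincomb[OF hol[OF f] hol[OF h] g])
    then have "volterra g d z - \<mu> * d z = 0" for z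
      using fun_cong[OF eq, of z] by (simp add: d_def algebra_simps)
    from volterra_resolvent_const[OF hol[OF \<open>d \<in> ?A\<close>] g \<mu> this]
    have "d z = 0" for z by simp
    then show "f = h" by (auto simp: d_def)
  qed
  have bij: "bij_betw ?S ?A ?A"
    unfolding bij_betw_def
  proof (intro conjI inj subset_antisym image_subsetI S)
    show "?A \<subseteq> ?S ` ?A"
    proof
      fix h assume h: "h \<in> ?A"
      show "h \<in> ?S ` ?A"
        using SR[OF h] step_bounded_algebra[OF R h] by (intro image_eqI[of _ ?S "?R h"]) simp_all
    qed
  qed
  have inv: "inv_into ?A ?S h = ?R h" if "h \<in> ?A" for h
    using inv_into_f_f[OF inj step_bounded_algebra[OF R that]] SR[OF that] by simp
  have "continuous_map ?X ?X ?R"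
  proof (rule step_bounded_continuous_map[OF p R])
    fix f h a b assume f: "f \<in> ?A" and h: "h \<in> ?A"
    have "volterra g (\<lambda>w. a * (exp (- 1 / \<mu> * g w) * f w) + b * (exp (- 1 / \<mu> * g w) * h w)) =
        (\<lambda>z. a * volterra g (\<lambda>w. exp (- 1 / \<mu> * g w) * f w) z
           + b * volterra g (\<lambda>w. exp (- 1 / \<mu> * g w) * h w) z)"
      using g hol[OF f] hol[OF h] by (intro volterra_lincomb holomorphic_intros)
    moreover have "(\<lambda>w. exp (- 1 / \<mu> * g w) * (a * f w + b * h w)) =
        (\<lambda>w. a * (exp (- 1 / \<mu> * g w) * f w) + b * (exp (- 1 / \<mu> * g w) * h w))"
      by (simp add: algebra_simps)
    ultimately show "?R (\<lambda>z. a * f z + b * h z) = (\<lambda>z. a * ?R f z + b * ?R h z)"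
      unfolding volterra_resolvent_def by (simp only:) (simp add: algebra_simps)
  qed
  then have "continuous_map ?X ?X (inv_into ?A ?S)"
    by (rule continuous_map_eq) (simp add: space inv)
  with bij have "\<mu> \<in> resolvent_set ?X (volterra g)"
    by (simp add: resolvent_set_def Let_def space)
  then show ?thesis by (simp add: spectrum_def)
qed

theorem theorem3p4:
  fixes p :: "complex \<Rightarrow> real" and g :: "complex \<Rightarrow> complex"
  assumes "growth_condition p"
    and "g \<in> hormander_algebra p"
    and "\<not> g constant_on UNIV"
  shows "(max_modulus g \<notin> O[at_top](\<lambda>r. p (complex_of_real r)) \<longrightarrow>
            spectrum (hormander_topology p) (volterra g) = UNIV)
    \<and> ((\<lambda>r. p (complex_of_real r)) \<in> o[at_top](\<lambda>r. r) \<longrightarrow>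
            max_modulus g \<notin> O[at_top](\<lambda>r. p (complex_of_real r)))
    \<and> (max_modulus g \<in> O[at_top](\<lambda>r. p (complex_of_real r)) \<longrightarrow>
            spectrum (hormander_topology p) (volterra g) = {0}
            \<and> (\<exists>q :: complex poly. g = poly q)
            \<and> (\<lambda>r. r) \<in> O[at_top](\<lambda>r. p (complex_of_real r)))
    \<and> spectrum (hormander_topology p) (volterra g) =
        {0} \<union> closure {\<mu>. \<mu> \<noteq> 0 \<and> (\<lambda>z. exp (g z / \<mu>)) \<notin> hormander_algebra p}"
proof -
  let ?O = "max_modulus g \<in> O[at_top](\<lambda>r. p (complex_of_real r))"
  let ?spec = "spectrum (hormander_topology p) (volterra g)"
  let ?E = "{\<mu>. \<mu> \<noteq> 0 \<and> (\<lambda>z. exp (g z / \<mu>)) \<notin> hormander_algebra p}"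
  note p = \<open>growth_condition p\<close>
  have g: "g holomorphic_on UNIV" using assms(2) by (simp add: hormander_algebra_iff)
  note O_iff = max_modulus_bigo_iff[OF p g]
  note zero = zero_in_spectrum_volterra[OF p, of g]
  have large: "?spec = UNIV \<and> ?E = - {0}" if "\<not> ?O"
  proof -
    have E: "(\<lambda>z. exp (g z / \<mu>)) \<notin> hormander_algebra p" if "\<mu> \<noteq> 0" for \<mu>
    proof
      assume "(\<lambda>z. exp (g z / \<mu>)) \<in> hormander_algebra p"
      from exp_in_algebra_imp_growth[OF p g that this] have ?O unfolding O_iff .
      with \<open>\<not> ?O\<close> show False ..
    qed
    have "\<mu> \<in> ?spec" for \<mu>
    proof (cases "\<mu> = 0")
      case False
      show ?thesis
        by (rule ccontr) (use E[OF False] resolvent_imp_exp_in_algebra[OF p g False] in blast)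
    qed (simp add: zero)
    with E show ?thesis by (simp add: set_eq_iff) blast
  qed
  have small: "?spec = {0} \<and> ?E = {} \<and> (\<exists>q. g = poly q) \<and>
      (\<lambda>r. r) \<in> O[at_top](\<lambda>r. p (complex_of_real r))" if ?O
  proof -
    obtain C D where CD: "\<And>z. cmod (g z) \<le> C * p z + D" using \<open>?O\<close> unfolding O_iff by blast
    obtain q where q: "g = poly q" using growth_imp_polynomial[OF p g CD] by blast
    have "\<mu> = 0" if "\<mu> \<in> ?spec" for \<mu>
      by (rule ccontr) (use growth_imp_in_resolvent_set[OF p g _ CD] that in blast)
    then have "?spec = {0}" using zero by (intro set_eqI) auto
    moreover have "(\<lambda>z. exp (g z / \<mu>)) \<in> hormander_algebra p" for \<mu>
      using exp_in_algebra[OF p g CD, of "1 / \<mu>"] by simp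
    then have "?E = {}" by simp
    moreover have "(\<lambda>r. r) \<in> O[at_top](\<lambda>r. p (complex_of_real r))"
      using growth_imp_id_bigo[OF p _ CD[unfolded q]] assms(3) q by simp
    ultimately show ?thesis using q by (intro conjI exI[of _ q])
  qed
  have slow: "\<not> ?O" if o: "(\<lambda>r. p (complex_of_real r)) \<in> o[at_top](\<lambda>r. r)"
  proof
    assume ?O
    then have "(\<lambda>r. r) \<in> O[at_top](\<lambda>r. p (complex_of_real r))" using small by blast
    then have "(\<lambda>r :: real. r) \<in> o[at_top](\<lambda>r. r)"
      using o by (rule landau_o.big_small_trans)
    then have "\<forall>\<^sub>F r :: real in at_top. r = 0"
      by (simp add: landau_o.small_refl_iff)
    then obtain N :: real where "\<And>r. N \<le> r \<Longrightarrow> r = 0"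
      by (auto simp: eventually_at_top_linorder)
    then have "max N 1 = 0" by simp
    then show False by (simp add: max_def split: if_splits)
  qed
  have spec: "?spec = {0} \<union> closure ?E"
  proof (cases ?O)
    case True
    then have "?spec = {0}" "?E = {}" using small by blast+
    then show ?thesis by (simp only: closure_empty Un_empty_right)
  next
    case False
    then have "?spec = UNIV" "?E = - {0}" using large by blast+
    moreover have "closure (- {0 :: complex}) = UNIV" by (simp add: closure_complement)
    ultimately show ?thesis by (simp only: Un_UNIV_right)
  qed
  show ?thesis
    by (intro conjI impI spec slow) (use large small in blast)+
qed

end
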